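(* Let $S\in\mathbb R^{d\times d}$ satisfy $S=S^\top\succ 0$ and define $\gamma_\star=\mathrm{Tr}(S)/d$. Then there exists an orthonormal basis $\Psi=[\psi_1,\ldots,\psi_d]$ of $\mathbb R^d$ (identified with the orthogonal matrix with columns $\psi_k$) satisfying $$\psi_k^\top S\psi_k=\gamma_\star,\qquad k=1,\ldots,d.$$ For any such basis, define $B=\Psi^\top S\Psi$ and let $M_\star=M_\star(\Psi)$ be the skew-symmetric matrix with $$(M_\star)_{jk}=\begin{cases}B_{jk}, & j<k,\\ 0, & j=k,\\ -B_{jk}, & j>k\end{cases}$$ (equivalently, $B+M_\star$ is upper triangular with all diagonal entries equal to $\gamma_\star$). Let $$\tilde J_\star=\Psi M_\star\Psi^\top,\qquad J_\star=S^{-1/2}\tilde J_\star S^{-1/2}.$$ Then $(\Psi,M_\star)$ is feasible for problem (P2), i.e., $J_\star\in\mathcal J_{\mathrm s}(S)$, and $$\min(\mathrm{P2})=\min(\mathrm{P1})=\mathrm{Tr}(-J_\star SJ_\star S)=\|S\|_F^2-d\gamma_\star^2=\|S\|_F^2-\frac{[\mathrm{Tr}(S)]^2}{d}.$$ Moreover, the set of global minimizers of (P1) is exactly $$\left\{S^{-1/2}\,\Psi M_\star(\Psi)\Psi^\top S^{-1/2}\;:\;\Psi\in\mathbb R^{d\times d},\ \Psi^\top\Psi=I,\ \operatorname{diag}(\Psi^\top S\Psi)=\gamma_\star\mathbf 1\right\}.$$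
   Context: All matrices are real $d\times d$. $\sigma_i(A)$, $i=1,\dots,d$, denote the (generally complex) eigenvalues of a matrix $A$, $\Re$ the real part, $\|\cdot\|_F$ the Frobenius norm, $S^{1/2}$ the symmetric positive definite square root of $S$ and $S^{-1/2}$ its inverse, $\operatorname{diag}(A)$ the vector of diagonal entries of $A$, and $\mathbf 1$ the all-ones vector. The spectrally optimal class is $$\mathcal J_{\mathrm s}(S)=\Bigl\{J\in\mathbb R^{d\times d}: J^\top=-J,\ \min_i\Re\bigl(\sigma_i((I+J)S)\bigr)=\mathrm{Tr}(S)/d\Bigr\}.$$ (Since the trace of $(I+J)S$ equals $\mathrm{Tr}(S)$ for skew-symmetric $J$, the condition is the same as $\Re[\sigma_i((I+J)S)]=\mathrm{Tr}(S)/d$ for all $i$.) Problem (P1): minimize $\mathrm{Tr}(-JSJS)$ over $J\in\mathbb R^{d\times d}$ with $J=-J^\top$, subject to $\Re[\sigma_i((I+J)S)]=\gamma_\star$ for all $i$. Problem (P2): minimize $\|M\|_F^2$ over pairs $(\Psi,M)$ of real $d\times d$ matrices subject to $\Psi^\top\Psi=I$, $M^\top=-M$, and $\Re[\sigma_i(\Psi^\top S\Psi+M)]=\gamma_\star$ for $i=1,\dots,d$. A feasible pair $(\Psi,M)$ of (P2) corresponds to the matrix $J=S^{-1/2}\Psi M\Psi^\top S^{-1/2}$ in (P1). *)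

theory Defs
  imports "Jordan_Normal_Form.Spectral_Radius" "Jordan_Normal_Form.Gauss_Jordan_Elimination"
begin

definition mat_trace :: "real mat \<Rightarrow> real" where
  "mat_trace A = (\<Sum>i<dim_row A. A $$ (i, i))"

definition frobenius_norm :: "real mat \<Rightarrow> real" where
  "frobenius_norm A = sqrt (\<Sum>i<dim_row A. \<Sum>j<dim_col A. (A $$ (i, j))\<^sup>2)"

definition sym_pos_def :: "real mat \<Rightarrow> bool" where
  "sym_pos_def A \<longleftrightarrow> square_mat A \<and> A\<^sup>T = A \<and>
     (\<forall>v \<in> carrier_vec (dim_row A). v \<noteq> 0\<^sub>v (dim_row A) \<longrightarrow> v \<bullet> (A *\<^sub>v v) > 0)"

(* Meaningful when S is symmetric positive definite; the root is then unique. *)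
definition mat_sqrt :: "real mat \<Rightarrow> real mat" where
  "mat_sqrt S = (THE R. sym_pos_def R \<and> R * R = S)"

definition mat_inv_sqrt :: "real mat \<Rightarrow> real mat" where
  "mat_inv_sqrt S = the (mat_inverse (mat_sqrt S))"

(* The eigenvalues of a real matrix are taken over the complex numbers. All conditions below
   concern only the real parts of all eigenvalues, so multiplicities play no role. *)
definition cspectrum :: "real mat \<Rightarrow> complex set" where
  "cspectrum A = spectrum (map_mat complex_of_real A)"

definition gamma_star :: "real mat \<Rightarrow> real" where
  "gamma_star S = mat_trace S / real (dim_row S)"

definition J_s :: "real mat \<Rightarrow> real mat set" where
  "J_s S = {J \<in> carrier_mat (dim_row S) (dim_row S). J\<^sup>T = - J \<and>
     Min (Re ` cspectrum ((1\<^sub>m (dim_row S) + J) * S)) = mat_trace S / real (dim_row S)}"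

definition P1_objective :: "real mat \<Rightarrow> real mat \<Rightarrow> real" where
  "P1_objective S J = mat_trace (- J * S * J * S)"

definition P1_feasible :: "real mat \<Rightarrow> real mat set" where
  "P1_feasible S = {J \<in> carrier_mat (dim_row S) (dim_row S). J = - J\<^sup>T \<and>
     (\<forall>s \<in> cspectrum ((1\<^sub>m (dim_row S) + J) * S). Re s = gamma_star S)}"

definition P2_objective :: "real mat \<times> real mat \<Rightarrow> real" where
  "P2_objective = (\<lambda>(Psi, M). (frobenius_norm M)\<^sup>2)"

definition P2_feasible :: "real mat \<Rightarrow> (real mat \<times> real mat) set" where
  "P2_feasible S = {(Psi, M).
     Psi \<in> carrier_mat (dim_row S) (dim_row S) \<and> M \<in> carrier_mat (dim_row S) (dim_row S) \<and>
     Psi\<^sup>T * Psi = 1\<^sub>m (dim_row S) \<and> M\<^sup>T = - M \<and>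
     (\<forall>s \<in> cspectrum (Psi\<^sup>T * S * Psi + M). Re s = gamma_star S)}"

definition is_min_value :: "('a \<Rightarrow> real) \<Rightarrow> 'a set \<Rightarrow> real \<Rightarrow> bool" where
  "is_min_value f X m \<longleftrightarrow> (\<exists>x\<in>X. f x = m) \<and> (\<forall>x\<in>X. m \<le> f x)"

definition global_minimizers :: "('a \<Rightarrow> real) \<Rightarrow> 'a set \<Rightarrow> 'a set" where
  "global_minimizers f X = {x. is_arg_min f (\<lambda>y. y \<in> X) x}"

definition M_star :: "real mat \<Rightarrow> real mat \<Rightarrow> real mat" where
  "M_star S Psi = (let B = Psi\<^sup>T * S * Psi in
     mat (dim_row S) (dim_row S)
       (\<lambda>(j, k). if j < k then B $$ (j, k) else if j = k then 0 else - B $$ (j, k)))"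

definition J_star :: "real mat \<Rightarrow> real mat \<Rightarrow> real mat" where
  "J_star S Psi = mat_inv_sqrt S * (Psi * M_star S Psi * Psi\<^sup>T) * mat_inv_sqrt S"

(* The columns of Psi are an orthonormal basis on which the quadratic form of S is
   constantly gamma_star S. *)
definition equalizing_basis :: "real mat \<Rightarrow> real mat \<Rightarrow> bool" where
  "equalizing_basis S Psi \<longleftrightarrow>
     Psi \<in> carrier_mat (dim_row S) (dim_row S) \<and> Psi\<^sup>T * Psi = 1\<^sub>m (dim_row S) \<and>
     (\<forall>k < dim_row S. col Psi k \<bullet> (S *\<^sub>v col Psi k) = gamma_star S)"

end

theory Submission
  imports Defs "Jordan_Normal_Form.Schur_Decomposition"
begin

text \<open>Let \<open>R\<close> be the positive definite square root of \<open>S\<close>. Conjugation by \<open>R\<close> turns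
  \<open>(I + J) S\<close> into \<open>A = S + K\<close> with \<open>K = R J R\<close> skew-symmetric, and the objective of (P1) becomes
  \<open>\<parallel>K\<parallel>\<^sup>2\<close> (Frobenius norm). Since a symmetric and a skew-symmetric matrix are
  orthogonal in the trace inner product,
  \<open>Tr (A\<^sup>2) = \<parallel>S\<parallel>\<^sup>2 - \<parallel>K\<parallel>\<^sup>2\<close>. On the other hand \<open>Tr (A\<^sup>2)\<close> is the sum of the squared eigenvalues,
  that is \<open>d \<gamma>\<^sup>2\<close> minus the sum of the squared imaginary parts when all real parts equal \<open>\<gamma>\<close>.
  Hence \<open>\<parallel>K\<parallel>\<^sup>2 \<ge> \<parallel>S\<parallel>\<^sup>2 - d \<gamma>\<^sup>2\<close>, with equality iff every eigenvalue of \<open>A\<close> is the real number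
  \<open>\<gamma>\<close>. In that case the real Schur form of \<open>A\<close> is upper triangular with constant diagonal \<open>\<gamma>\<close>; its
  orthogonal factor equalizes the diagonal of \<open>S\<close> and determines \<open>K\<close>. An equalizing basis exists
  because a rotation in the plane of a too small and a too large diagonal entry makes one of them
  equal to \<open>\<gamma>\<close> without touching the other ones.\<close>

section \<open>Trace, Frobenius norm and complex spectrum\<close>

definition trace :: "'a::comm_monoid_add mat \<Rightarrow> 'a" where
  "trace A = (\<Sum>i<dim_row A. A $$ (i, i))"

lemma mat_trace_eq_trace: "mat_trace = trace"
  by (rule ext) (simp add: mat_trace_def trace_def)

lemma trace_mult:
  assumes "A \<in> carrier_mat n m" "B \<in> carrier_mat m n"
  shows "trace (A * B) = (\<Sum>i<n. \<Sum>j<m. A $$ (i, j) * B $$ (j, i))"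
proof -
  have "(A * B) $$ (i, i) = (\<Sum>j<m. A $$ (i, j) * B $$ (j, i))" if "i < n" for i
    using assms that by (auto simp: scalar_prod_def atLeast0LessThan intro!: sum.cong)
  then show ?thesis using assms by (auto simp: trace_def)
qed

lemma trace_mult_comm:
  fixes A B :: "'a::comm_semiring_0 mat"
  assumes A: "A \<in> carrier_mat n m" and B: "B \<in> carrier_mat m n"
  shows "trace (A * B) = trace (B * A)"
  unfolding trace_mult[OF A B] trace_mult[OF B A]
  by (subst sum.swap) (simp add: mult.commute)

lemma trace_transpose: "A \<in> carrier_mat n n \<Longrightarrow> trace A\<^sup>T = trace A"
  by (auto simp: trace_def)

lemma trace_add:
  "A \<in> carrier_mat n n \<Longrightarrow> B \<in> carrier_mat n n \<Longrightarrow> trace (A + B) = trace A + trace B"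
  by (auto simp: trace_def sum.distrib)

lemma trace_uminus:
  fixes A :: "'a::ab_group_add mat"
  shows "A \<in> carrier_mat n n \<Longrightarrow> trace (- A) = - trace A"
  by (auto simp: trace_def sum_negf)

lemma trace_similar:
  fixes A :: "'a::comm_semiring_1 mat"
  assumes "similar_mat A B"
  shows "trace A = trace B"
proof -
  from similar_matD[OF assms] obtain n P Q where
    c: "A \<in> carrier_mat n n" "B \<in> carrier_mat n n" "P \<in> carrier_mat n n" "Q \<in> carrier_mat n n"
    and QP: "Q * P = 1\<^sub>m n" and A: "A = P * B * Q" by auto
  have "trace A = trace (P * (B * Q))" using c unfolding A by simp
  also have "\<dots> = trace (B * Q * P)" using c by (intro trace_mult_comm) auto
  also have "B * Q * P = B" using c QP by simp
  finally show ?thesis .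
qed

lemma similar_mat_square:
  assumes "similar_mat A B"
  shows "similar_mat (A * A) (B * B)"
proof -
  from similar_matD[OF assms] obtain n P Q where
    c: "A \<in> carrier_mat n n" "B \<in> carrier_mat n n" "P \<in> carrier_mat n n" "Q \<in> carrier_mat n n"
    and QP: "P * Q = 1\<^sub>m n" "Q * P = 1\<^sub>m n" and A: "A = P * B * Q" by auto
  have "A * A = P * (B * ((Q * P) * (B * Q)))" using c unfolding A by (simp add: assoc_mult_mat[of _ n n _ n _ n])
  also have "\<dots> = P * (B * B) * Q" using c QP(2) by (simp add: assoc_mult_mat[of _ n n _ n _ n])
  finally show ?thesis using c QP by (intro similar_matI[of _ _ P Q n]) auto
qed

text \<open>For \<open>k \<noteq> i\<close>, one of the factors \<open>T $$ (i, k)\<close> and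
  \<open>T $$ (k, i)\<close> lies strictly below the diagonal, so a single summand survives.\<close>

lemma upper_triangular_square_diag:
  fixes T :: "'a::semiring_1 mat"
  assumes T: "T \<in> carrier_mat n n" and ut: "upper_triangular T" and i: "i < n"
  shows "(T * T) $$ (i, i) = (T $$ (i, i))\<^sup>2"
proof -
  have "(T * T) $$ (i, i) = (\<Sum>k<n. T $$ (i, k) * T $$ (k, i))"
    using T i by (auto simp: scalar_prod_def atLeast0LessThan intro!: sum.cong)
  also have "\<dots> = (\<Sum>k<n. if k = i then (T $$ (i, i))\<^sup>2 else 0)"
  proof (rule sum.cong[OF refl])
    fix k assume "k \<in> {..<n}"
    then show "T $$ (i, k) * T $$ (k, i) = (if k = i then (T $$ (i, i))\<^sup>2 else 0)"
      using upper_triangularD[OF ut, of k i] upper_triangularD[OF ut, of i k] T i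
      by (cases k i rule: linorder_cases) (auto simp: power2_eq_square)
  qed
  finally show ?thesis using i by simp
qed

text \<open>Complex Schur triangularization preserves the trace of the square, and squaring a
  triangular matrix squares its diagonal. The list \<open>es\<close> keeps algebraic multiplicities,
  which \<open>spectrum\<close> forgets and the sum needs.\<close>

lemma trace_square_eigenvalues:
  fixes A :: "complex mat"
  assumes A: "A \<in> carrier_mat n n"
  obtains es where "length es = n" "set es = spectrum A" "char_poly A = (\<Prod>e\<leftarrow>es. [:- e, 1:])"
    "trace (A * A) = (\<Sum>i<n. (es ! i)\<^sup>2)"
proof -
  from char_poly_factorized[OF A] obtain es where
    cp: "char_poly A = (\<Prod>e\<leftarrow>es. [:- e, 1:])" and len: "length es = n" by blast
  obtain T P Q where "schur_decomposition A es = (T, P, Q)" by (metis prod_cases3)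
  from schur_decomposition[OF A cp this] have sim: "similar_mat A T" and ut: "upper_triangular T"
    and diag: "diag_mat T = es" by (auto simp: similar_mat_def)
  have T: "T \<in> carrier_mat n n" using similar_matD[OF sim] A by fastforce
  have "trace (A * A) = trace (T * T)" by (intro trace_similar similar_mat_square sim)
  also have "\<dots> = (\<Sum>i<n. (es ! i)\<^sup>2)"
    using T upper_triangular_square_diag[OF T ut] unfolding trace_def diag[symmetric]
    by (auto simp: diag_mat_def intro!: sum.cong)
  moreover have "set es = spectrum A"
    unfolding spectrum_root_char_poly[OF A] cp by (auto simp: poly_prod_list prod_list_zero_iff o_def)
  ultimately show thesis using that len cp by simp
qed

lemma frobenius_norm_square:
  "A \<in> carrier_mat n m \<Longrightarrow> (frobenius_norm A)\<^sup>2 = trace (A\<^sup>T * A)"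
  by (subst trace_mult[of _ m n], simp, simp, subst sum.swap,
      auto simp: frobenius_norm_def power2_eq_square sum_nonneg)

text \<open>Reading complex eigenvalues off the real characteristic polynomial lets similarity over
  the reals transfer the complex spectrum.\<close>

lemma cspectrum_char_poly:
  assumes "A \<in> carrier_mat n n"
  shows "cspectrum A = {z. poly (map_poly complex_of_real (char_poly A)) z = 0}"
  using spectrum_root_char_poly[of "map_mat complex_of_real A" n] assms
  by (simp add: cspectrum_def of_real_hom.char_poly_hom[OF assms])

lemma cspectrum_similar:
  assumes "similar_mat A B"
  shows "cspectrum A = cspectrum B"
proof -
  from similar_matD[OF assms] obtain n where "A \<in> carrier_mat n n" "B \<in> carrier_mat n n" by auto
  then show ?thesis using char_poly_similar[OF assms] by (simp add: cspectrum_char_poly)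
qed

lemma map_poly_of_real_linear_factors:
  "map_poly complex_of_real (\<Prod>a\<leftarrow>as. [:- a, 1:]) = (\<Prod>a\<leftarrow>as. [:- complex_of_real a, 1:])"
proof -
  interpret map_poly_comm_ring_hom complex_of_real ..
  show ?thesis by (induction as) (simp_all add: hom_distribs)
qed

lemma cspectrum_upper_triangular:
  assumes A: "A \<in> carrier_mat n n" and ut: "upper_triangular A"
  shows "cspectrum A = complex_of_real ` set (diag_mat A)"
proof -
  have "map_poly complex_of_real (char_poly A) = (\<Prod>a\<leftarrow>diag_mat A. [:- complex_of_real a, 1:])"
    unfolding char_poly_upper_triangular[OF A ut] by (rule map_poly_of_real_linear_factors)
  then show ?thesis unfolding cspectrum_char_poly[OF A]
    by (auto simp: poly_prod_list prod_list_zero_iff o_def)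
qed

text \<open>Every root is the image of its real part, and \<open>complex_of_real\<close> is
  injective on coefficients, so the complex factorization descends to the reals. This supplies the
  splitting hypothesis of \<open>real_schur\<close>.\<close>

lemma char_poly_real_factorized:
  assumes A: "A \<in> carrier_mat n n" and real: "\<And>s. s \<in> cspectrum A \<Longrightarrow> Im s = 0"
  obtains es where "char_poly A = (\<Prod>e\<leftarrow>es. [:- e, 1:])"
proof -
  have cA: "map_mat complex_of_real A \<in> carrier_mat n n" using A by simp
  from trace_square_eigenvalues[OF cA] obtain es where
    es: "set es = cspectrum A" "char_poly (map_mat complex_of_real A) = (\<Prod>e\<leftarrow>es. [:- e, 1:])"
    unfolding cspectrum_def by metis
  have "map_poly complex_of_real (char_poly A) = (\<Prod>e\<leftarrow>es. [:- e, 1:])"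
    using es(2) by (simp add: of_real_hom.char_poly_hom[OF A])
  also have "\<dots> = (\<Prod>e\<leftarrow>es. [:- complex_of_real (Re e), 1:])"
    using es(1) real by (intro arg_cong[of _ _ prod_list] map_cong) (auto simp: complex_eq_iff)
  also have "\<dots> = map_poly complex_of_real (\<Prod>e\<leftarrow>map Re es. [:- e, 1:])"
    unfolding map_poly_of_real_linear_factors by (simp add: o_def)
  finally have "char_poly A = (\<Prod>e\<leftarrow>map Re es. [:- e, 1:])"
    by (simp add: poly_eq_iff coeff_map_poly)
  then show thesis by (rule that)
qed

section \<open>Orthogonal triangularization over the reals\<close>

definition orth_mat :: "nat \<Rightarrow> real mat \<Rightarrow> bool" where
  "orth_mat n U \<longleftrightarrow> U \<in> carrier_mat n n \<and> U\<^sup>T * U = 1\<^sub>m n"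

lemma orth_matD:
  assumes "orth_mat n U"
  shows "U \<in> carrier_mat n n" "U\<^sup>T \<in> carrier_mat n n" "U\<^sup>T * U = 1\<^sub>m n" "U * U\<^sup>T = 1\<^sub>m n"
  using assms mat_mult_left_right_inverse[of "U\<^sup>T" n U] by (auto simp: orth_mat_def)

lemma orth_mat_cancel:
  assumes "orth_mat n U" "X \<in> carrier_mat n m"
  shows "U\<^sup>T * (U * X) = X" "U * (U\<^sup>T * X) = X"
  using assms(2) orth_matD[OF assms(1)]
  by (simp_all flip: assoc_mult_mat[of _ n n _ n _ m])

lemma orth_mat_one: "orth_mat n (1\<^sub>m n)"
  by (simp add: orth_mat_def)

lemma orth_mat_mult:
  assumes U: "orth_mat n U" and V: "orth_mat n V"
  shows "orth_mat n (U * V)"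
proof -
  note c = orth_matD(1,2)[OF U] orth_matD(1,2)[OF V]
  have "(U * V)\<^sup>T * (U * V) = V\<^sup>T * (U\<^sup>T * (U * V))"
    using c by (simp add: transpose_mult[of _ n n _ n] assoc_mult_mat[of _ n n _ n _ n])
  also have "\<dots> = 1\<^sub>m n" using c orth_mat_cancel(1)[OF U, of V n] orth_matD(3)[OF V] by simp
  finally show ?thesis using c by (simp add: orth_mat_def)
qed

lemma orth_similar:
  assumes U: "orth_mat n U" and A: "A \<in> carrier_mat n n"
  shows "similar_mat (U\<^sup>T * A * U) A"
  using assms orth_matD[OF U] by (intro similar_matI[of _ _ "U\<^sup>T" U n]) auto

lemma transpose_congruence:
  fixes U A :: "'a::comm_semiring_0 mat"
  assumes "U \<in> carrier_mat n n" "A \<in> carrier_mat n n"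
  shows "(U\<^sup>T * A * U)\<^sup>T = U\<^sup>T * A\<^sup>T * U"
  using assms by (simp add: transpose_mult[of _ n n _ n] assoc_mult_mat[of _ n n _ n _ n])

text \<open>Complete \<open>v\<close> to a basis starting with \<open>v\<close>, apply Gram-Schmidt,
  which leaves the first vector unchanged, and normalize; \<open>c\<close> is the inverse of the
  length of \<open>v\<close>.\<close>

lemma orth_mat_with_first_column:
  fixes v :: "real vec"
  assumes v: "v \<in> carrier_vec n" and v0: "v \<noteq> 0\<^sub>v n"
  obtains W c where "orth_mat n W" "c \<noteq> 0" "col W 0 = c \<cdot>\<^sub>v v"
proof -
  interpret cof_vec_space n "TYPE(real)" .
  define b where "b = basis_completion v"
  define ws where "ws = gram_schmidt n b"
  from basis_completion[OF v v0, folded b_def]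
  have b: "distinct b" "\<not> lin_dep (set b)" "set b \<subseteq> carrier_vec n" "hd b = v" "length b = n"
    by auto
  have n: "0 < n" using v v0 by (cases n) auto
  with b(4,5) obtain vs where bv: "b = v # vs" by (cases b) auto
  from gram_schmidt_result[OF b(3,1,2) refl, folded ws_def] b(5)
  have ws: "set ws \<subseteq> carrier_vec n" "corthogonal ws" "length ws = n" by auto
  have "hd ws = v" using gram_schmidt_hd[OF v, of vs] by (simp add: ws_def bv)
  then have ws0: "ws ! 0 = v" using ws(3) n by (metis hd_conv_nth length_0_conv less_numeral_extra(3))
  have car: "ws ! j \<in> carrier_vec n" if "j < n" for j using ws that by auto
  define r where "r j = sqrt (ws ! j \<bullet> ws ! j)" for j
  \<comment> \<open>On real vectors conjugation is trivial, so \<open>corthogonal\<close> is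
    ordinary orthogonality; its case \<open>i = j\<close> says that no \<open>ws ! j\<close>
    vanishes, which makes the normalization possible.\<close>
  have orth: "ws ! i \<bullet> ws ! j = 0 \<longleftrightarrow> i \<noteq> j" if "i < n" "j < n" for i j
    using corthogonalD[OF ws(2), of i j] that ws(3) by (simp add: conjugate_vec_def)
  have nn: "ws ! j \<bullet> ws ! j \<ge> 0" for j by (simp add: scalar_prod_def sum_nonneg)
  have r: "r j \<noteq> 0" "r j * r j = ws ! j \<bullet> ws ! j" if "j < n" for j
    using orth[OF that that] nn by (auto simp: r_def)
  define W where "W = mat n n (\<lambda>(i, j). (ws ! j) $ i / r j)"
  have col: "col W j = (1 / r j) \<cdot>\<^sub>v ws ! j" if "j < n" for j
    using car[OF that] that by (intro eq_vecI) (auto simp: W_def)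
  have W: "W \<in> carrier_mat n n" by (simp add: W_def)
  have "W\<^sup>T * W = 1\<^sub>m n"
  proof (rule eq_matI)
    fix i j assume ij: "i < dim_row (1\<^sub>m n :: real mat)" "j < dim_col (1\<^sub>m n :: real mat)"
    then have "(W\<^sup>T * W) $$ (i, j) = (1 / r i) * ((1 / r j) * (ws ! i \<bullet> ws ! j))"
      using W car by (simp add: col smult_scalar_prod_distrib[of _ n] scalar_prod_smult_distrib[of _ n])
    also have "\<dots> = 1\<^sub>m n $$ (i, j)"
      using ij orth[of i j] r[of i] by (cases "i = j") auto
    finally show "(W\<^sup>T * W) $$ (i, j) = 1\<^sub>m n $$ (i, j)" .
  qed (use W in auto)
  with W have "orth_mat n W" by (simp add: orth_mat_def)
  moreover have "1 / r 0 \<noteq> 0" "col W 0 = (1 / r 0) \<cdot>\<^sub>v v" using r(1)[OF n] col[OF n] ws0 by auto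
  ultimately show thesis by (rule that)
qed

text \<open>Deflation: an orthogonal \<open>W\<close> whose first column is an eigenvector for
  \<open>e\<close> splits \<open>e\<close> off as a 1 by 1 block, and the remaining block has the
  characteristic polynomial given by the tail \<open>es\<close>, so the induction hypothesis
  triangularizes it.\<close>

lemma real_schur:
  assumes "A \<in> carrier_mat n n" "char_poly A = (\<Prod>e\<leftarrow>es. [:- e, 1:])"
  shows "\<exists>U. orth_mat n U \<and> upper_triangular (U\<^sup>T * A * U)"
  using assms
proof (induction es arbitrary: n A)
  case Nil
  \<comment> \<open>The empty product has degree 0, whereas the characteristic polynomial has degree
    \<open>n\<close>.\<close>
  then have "n = 0" using degree_monic_char_poly[of A n] by simp
  then show ?case by (intro exI[of _ "1\<^sub>m n"]) (auto simp: orth_mat_one)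
next
  case (Cons e es)
  note A = Cons.prems(1)
  have "eigenvalue A e" unfolding eigenvalue_root_char_poly[OF A] Cons.prems(2) by simp
  then obtain v where v: "v \<in> carrier_vec n" "v \<noteq> 0\<^sub>v n" "A *\<^sub>v v = e \<cdot>\<^sub>v v"
    using A by (auto simp: eigenvalue_def eigenvector_def)
  from v(1,2) obtain m where n: "n = Suc m" by (cases n) auto
  from orth_mat_with_first_column[OF v(1,2)] obtain W c where
    W: "orth_mat n W" and col: "col W 0 = c \<cdot>\<^sub>v v" by blast
  note Wc = orth_matD[OF W]
  define A' where "A' = W\<^sup>T * A * W"
  have A': "A' \<in> carrier_mat n n" using A Wc by (simp add: A'_def)
  have Wcol: "col W 0 \<in> carrier_vec n" using col_carrier_vec[OF _ Wc(1), of 0] n by simp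
  have "A *\<^sub>v col W 0 = e \<cdot>\<^sub>v col W 0"
    using A v by (auto simp: col mult_mat_vec smult_smult_assoc mult.commute)
  \<comment> \<open>The right-hand side is kept as a column of \<open>W\<^sup>T * W\<close>, so that
    orthogonality turns it into \<open>e\<close> times the first unit vector.\<close>
  then have "col A' 0 = e \<cdot>\<^sub>v col (W\<^sup>T * W) 0"
    using A Wc(1,2) Wcol n by (simp add: A'_def col_mult2[of _ n n _ n] assoc_mult_mat[of _ n n _ n _ n] mult_mat_vec[of _ n n] del: col_mult)
  then have col0: "A' $$ (i, 0) = (if i = 0 then e else 0)" if "i < n" for i
    using that A' n Wc(3) by (auto simp: vec_eq_iff dest!: spec[of _ i])
  obtain A1 A2 A0 A3 where sp: "split_block A' 1 1 = (A1, A2, A0, A3)" by (metis prod_cases4)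
  have dims: "dim_row A' = 1 + m" "dim_col A' = 1 + m" using A' n by auto
  note blk = split_block[OF sp dims]
  have A1: "A1 = mat 1 1 (\<lambda>_. e)"
    using sp col0[of 0] n by (auto simp: split_block_def Let_def)
  have A0: "A0 = 0\<^sub>m m 1"
    using sp col0 n A' by (auto simp: split_block_def Let_def)
  have "[:- e, 1:] * (\<Prod>e\<leftarrow>es. [:- e, 1:]) = char_poly A'"
    using char_poly_similar[OF orth_similar[OF W A]] Cons.prems(2) by (simp add: A'_def)
  also have "\<dots> = char_poly A1 * char_poly A3"
    unfolding blk(5) A0 by (rule char_poly_four_block_zeros_col[OF blk(1,2,4)])
  also have "char_poly A1 = [:- e, 1:]" by (simp add: A1 char_poly_defs det_def sign_def)
  finally have "char_poly A3 = (\<Prod>e\<leftarrow>es. [:- e, 1:])"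
    by (metis mult_cancel_left pCons_eq_0_iff zero_neq_one)
  from Cons.IH[OF blk(4) this] obtain V where
    V: "orth_mat m V" and ut: "upper_triangular (V\<^sup>T * A3 * V)" by blast
  note Vc = orth_matD[OF V]
  \<comment> \<open>\<open>V'\<close> fixes the first coordinate and acts as \<open>V\<close> on the
    others; hence it does not disturb the zeros below \<open>e\<close>.\<close>
  define V' where "V' = four_block_mat (1\<^sub>m 1) (0\<^sub>m 1 m) (0\<^sub>m m 1) V"
  have V'c: "V' \<in> carrier_mat n n" using four_block_carrier_mat[OF one_carrier_mat[of 1] Vc(1)] n by (simp add: V'_def)
  have V'T: "V'\<^sup>T = four_block_mat (1\<^sub>m 1) (0\<^sub>m 1 m) (0\<^sub>m m 1) V\<^sup>T"
    unfolding V'_def using Vc by (subst transpose_four_block_mat[of _ 1 1 _ m _ m]) auto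
  have "V'\<^sup>T * V' = 1\<^sub>m n"
    unfolding V'T unfolding V'_def using Vc n
    by (subst mult_four_block_mat[of _ 1 1 _ m _ m _ _ 1 _ m]) (auto intro!: eq_matI)
  then have V': "orth_mat n V'" using V'c by (simp add: orth_mat_def)
  have "V'\<^sup>T * A' * V' = four_block_mat A1 (A2 * V) (0\<^sub>m m 1) (V\<^sup>T * A3 * V)"
    unfolding V'T blk(5) A0 unfolding V'_def using Vc blk
    by (subst mult_four_block_mat[of _ 1 1 _ m _ m _ _ 1 _ m], (simp_all)[8],
        subst mult_four_block_mat[of _ 1 1 _ m _ m _ _ 1 _ m]) auto
  moreover have "upper_triangular \<dots>"
    using ut blk Vc by (intro upper_triangular_four_block[of _ 1 _ m]) (auto simp: A1)
  moreover have "V'\<^sup>T * A' * V' = (W * V')\<^sup>T * A * (W * V')"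
    using A Wc V'c by (simp add: A'_def transpose_mult[of _ n n _ n] assoc_mult_mat[of _ n n _ n _ n])
  ultimately show ?case using orth_mat_mult[OF W V'] by auto
qed

section \<open>The symmetric positive definite square root\<close>

text \<open>For an eigenvector \<open>v\<close>, the form
  \<open>conjugate v \<bullet> (C *\<^sub>v v)\<close> can be evaluated on either side by symmetry.
  This gives \<open>s\<close> and \<open>cnj s\<close> times the same nonzero number.\<close>

lemma symmetric_cspectrum_real:
  assumes A: "A \<in> carrier_mat n n" and sym: "A\<^sup>T = A" and s: "s \<in> cspectrum A"
  shows "Im s = 0"
proof -
  define C where "C = map_mat complex_of_real A"
  have C: "C \<in> carrier_mat n n" "C\<^sup>T = C" using A sym by (simp_all add: C_def map_mat_transpose)
  from s obtain v where v: "v \<in> carrier_vec n" "v \<noteq> 0\<^sub>v n" "C *\<^sub>v v = s \<cdot>\<^sub>v v"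
    using C unfolding cspectrum_def spectrum_def C_def[symmetric]
    by (auto simp: eigenvalue_def eigenvector_def)
  have cv: "conjugate v \<in> carrier_vec n" using v by simp
  have "C *\<^sub>v conjugate v = conjugate (C *\<^sub>v v)"
    using A v(1) by (intro eq_vecI) (auto simp: C_def scalar_prod_def)
  then have conj: "C *\<^sub>v conjugate v = cnj s \<cdot>\<^sub>v conjugate v"
    using v(1) by (auto simp: v(3))
  have "s * (conjugate v \<bullet> v) = conjugate v \<bullet> (C *\<^sub>v v)" using v cv by simp
  also have "\<dots> = (C *\<^sub>v conjugate v) \<bullet> v"
    using transpose_vec_mult_scalar[OF C(1) v(1) cv] C(2) by simp
  also have "\<dots> = cnj s * (conjugate v \<bullet> v)" using v cv by (simp add: conj)
  finally have "s * (conjugate v \<bullet> v) = cnj s * (conjugate v \<bullet> v)" .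
  moreover have "conjugate v \<bullet> v \<noteq> 0"
    using conjugate_square_eq_0_vec[OF v(1)] v(2) comm_scalar_prod[OF cv v(1)] by simp
  ultimately have "s = cnj s" by simp
  then show ?thesis by (simp add: complex_eq_iff)
qed

text \<open>Entries of a congruence are values of the bilinear form at the columns. This translates
  \<open>equalizing_basis\<close> into a condition on a diagonal and makes positive definiteness
  applicable to diagonal entries.\<close>

lemma congruence_index:
  fixes S X :: "real mat"
  assumes "S \<in> carrier_mat n n" "X \<in> carrier_mat n n" "i < n" "j < n"
  shows "(X\<^sup>T * S * X) $$ (i, j) = col X i \<bullet> (S *\<^sub>v col X j)"
  using assms by (simp add: assoc_mult_mat[of _ n n _ n _ n] col_mult2[of _ n n _ n] del: col_mult)

lemma sym_pos_def_congruence_index_nonneg: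
  assumes "sym_pos_def S" "S \<in> carrier_mat n n" "X \<in> carrier_mat n n" "i < n"
  shows "(X\<^sup>T * S * X) $$ (i, i) \<ge> 0"
    and "(X\<^sup>T * S * X) $$ (i, i) = 0 \<Longrightarrow> col X i = 0\<^sub>v n"
proof -
  have c: "col X i \<in> carrier_vec n" using assms by auto
  then have "col X i = 0\<^sub>v n \<or> 0 < col X i \<bullet> (S *\<^sub>v col X i)"
    using assms(1,2) by (auto simp: sym_pos_def_def)
  moreover have "(0\<^sub>v n :: real vec) \<bullet> (S *\<^sub>v 0\<^sub>v n) = 0" using assms(2) by simp
  ultimately show "(X\<^sup>T * S * X) $$ (i, i) \<ge> 0"
    and "(X\<^sup>T * S * X) $$ (i, i) = 0 \<Longrightarrow> col X i = 0\<^sub>v n"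
    using congruence_index[OF assms(2,3,4,4)] by auto
qed

text \<open>The real Schur form of a symmetric matrix is both symmetric and triangular, hence
  diagonal; here its entries are positive. Taking their roots and conjugating back gives
  \<open>R\<close>.\<close>

lemma sym_pos_def_sqrt_exists:
  assumes S: "S \<in> carrier_mat n n" and spd: "sym_pos_def S"
  shows "\<exists>R. sym_pos_def R \<and> R * R = S"
proof -
  have sym: "S\<^sup>T = S" using spd by (simp add: sym_pos_def_def)
  obtain es where "char_poly S = (\<Prod>e\<leftarrow>es. [:- e, 1:])"
    using char_poly_real_factorized[OF S symmetric_cspectrum_real[OF S sym]] by blast
  from real_schur[OF S this] obtain U where
    U: "orth_mat n U" and ut: "upper_triangular (U\<^sup>T * S * U)" by blast
  note Uc = orth_matD[OF U]
  define D where "D = U\<^sup>T * S * U"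
  have D: "D \<in> carrier_mat n n" using S Uc by (simp add: D_def)
  have DT: "D\<^sup>T = D" using transpose_congruence[OF Uc(1) S] by (simp add: D_def sym)
  have off: "D $$ (i, j) = 0" if "i < n" "j < n" "i \<noteq> j" for i j
    using upper_triangularD[OF ut, folded D_def, of i j] upper_triangularD[OF ut, folded D_def, of j i]
      that D arg_cong[OF DT, of "\<lambda>X. X $$ (i, j)"] by (cases i j rule: linorder_cases) auto
  have pos: "D $$ (i, i) > 0" if i: "i < n" for i
  proof -
    have "col U i \<noteq> 0\<^sub>v n"
    proof
      assume "col U i = 0\<^sub>v n"
      moreover have "(U\<^sup>T * U) $$ (i, i) = col U i \<bullet> col U i" using Uc(1) i by simp
      ultimately show False using Uc(3) i by simp
    qed
    then show ?thesis using sym_pos_def_congruence_index_nonneg[OF spd S Uc(1) i]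
      unfolding D_def by fastforce
  qed
  define E where "E = mat n n (\<lambda>(i, j). if i = j then sqrt (D $$ (i, i)) else 0)"
  have E: "E \<in> carrier_mat n n" "E\<^sup>T = E" by (auto simp: E_def)
  have EE: "E * E = D"
  proof (rule eq_matI)
    fix i j assume ij: "i < dim_row D" "j < dim_col D"
    then have "(E * E) $$ (i, j) = (\<Sum>k\<in>{0..<n}. E $$ (i, k) * E $$ (k, j))"
      using D E(1) by (simp add: scalar_prod_def)
    also have "\<dots> = (\<Sum>k\<in>{0..<n}. if k = i then E $$ (i, i) * E $$ (i, j) else 0)"
      using ij D by (intro sum.cong) (auto simp: E_def)
    also have "\<dots> = E $$ (i, i) * E $$ (i, j)" using ij D by simp
    also have "\<dots> = D $$ (i, j)"
      using ij D off[of i j] pos[of i] by (cases "i = j") (simp_all add: E_def)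
    finally show "(E * E) $$ (i, j) = D $$ (i, j)" .
  qed (use D E in auto)
  define R where "R = U * E * U\<^sup>T"
  have R: "R \<in> carrier_mat n n" using Uc E by (simp add: R_def)
  have RT: "R\<^sup>T = R"
    using transpose_congruence[OF Uc(2) E(1)] E(2) by (simp add: R_def)
  have "R * R = U * (E * (U\<^sup>T * (U * (E * U\<^sup>T))))"
    using Uc E by (simp add: R_def assoc_mult_mat[of _ n n _ n _ n])
  also have "\<dots> = U * (E * E * U\<^sup>T)"
    using Uc E by (simp add: orth_mat_cancel(1)[OF U, of _ n] assoc_mult_mat[of _ n n _ n _ n])
  also have "\<dots> = U * (U\<^sup>T * (S * (U * U\<^sup>T)))"
    using Uc(1,2) S by (simp add: EE D_def assoc_mult_mat[of _ n n _ n _ n])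
  also have "\<dots> = S"
    using Uc S by (simp add: orth_mat_cancel(2)[OF U, of _ n])
  finally have RR: "R * R = S" .
  have "v \<bullet> (R *\<^sub>v v) > 0" if v: "v \<in> carrier_vec n" "v \<noteq> 0\<^sub>v n" for v
  proof -
    \<comment> \<open>In the coordinates \<open>w\<close> the quadratic form of \<open>R\<close> is
      a sum of squares with the positive weights \<open>sqrt (D $$ (i, i))\<close>, and
      \<open>w\<close> is nonzero because \<open>U\<close> is invertible.\<close>
    define w where "w = U\<^sup>T *\<^sub>v v"
    have w: "w \<in> carrier_vec n" using Uc v by (simp add: w_def)
    have "U *\<^sub>v w = v" using v Uc by (simp add: w_def flip: assoc_mult_mat_vec[of _ n n _ n])
    then have "w \<noteq> 0\<^sub>v n" using v Uc(1) by auto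
    then obtain k where k: "k < n" "w $ k \<noteq> 0" using w by (auto simp: vec_eq_iff)
    have "R *\<^sub>v v = U *\<^sub>v (E *\<^sub>v w)"
      using Uc E v by (simp add: R_def w_def assoc_mult_mat_vec[of _ n n _ n])
    then have "v \<bullet> (R *\<^sub>v v) = w \<bullet> (E *\<^sub>v w)"
      using transpose_vec_mult_scalar[OF Uc(1) _ v(1), of "E *\<^sub>v w"] E w by (simp add: w_def)
    also have "\<dots> = (\<Sum>i<n. sqrt (D $$ (i, i)) * (w $ i)\<^sup>2)"
    proof -
      have "(E *\<^sub>v w) $ i = sqrt (D $$ (i, i)) * w $ i" if "i < n" for i
      proof -
        have "(E *\<^sub>v w) $ i = (\<Sum>j\<in>{0..<n}. E $$ (i, j) * w $ j)"
          using that w E(1) by (simp add: scalar_prod_def)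
        also have "\<dots> = (\<Sum>j\<in>{0..<n}. if j = i then sqrt (D $$ (i, i)) * w $ i else 0)"
          using that by (intro sum.cong) (auto simp: E_def)
        finally show ?thesis using that by simp
      qed
      then show ?thesis using w E
        by (auto simp: scalar_prod_def atLeast0LessThan power2_eq_square intro!: sum.cong)
    qed
    also have "\<dots> > 0"
      using k pos by (intro sum_pos2[of _ k]) (auto simp: less_imp_le)
    finally show ?thesis .
  qed
  then have "sym_pos_def R" using R RT by (auto simp: sym_pos_def_def)
  with RR show ?thesis by blast
qed

text \<open>The difference \<open>X\<close> satisfies
  \<open>R1 * X + X * R2 = R1 * R1 - R2 * R2\<close>, which is zero. Multiplying by \<open>X\<close>
  and taking traces leaves a vanishing sum of nonnegative values of the two forms at the columns of
  \<open>X\<close>, so all columns are zero.\<close>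

lemma sym_pos_def_sqrt_unique:
  assumes R1: "R1 \<in> carrier_mat n n" "sym_pos_def R1" and R2: "R2 \<in> carrier_mat n n" "sym_pos_def R2"
    and eq: "R1 * R1 = R2 * R2"
  shows "R1 = R2"
proof -
  define X where "X = R1 - R2"
  have X: "X \<in> carrier_mat n n" "X\<^sup>T = X"
    using R1 R2 by (auto simp: X_def sym_pos_def_def transpose_minus[of _ n n])
  have "R1 * X + X * R2 = (R1 * R1 - R1 * R2) + (R1 * R2 - R2 * R2)"
    unfolding X_def using R1(1) R2(1)
    by (simp add: mult_minus_distrib_mat[of _ n n _ n] minus_mult_distrib_mat[of _ n n _ _ n])
  also have "\<dots> = 0\<^sub>m n n" using R1(1) R2(1) by (auto simp: eq)
  finally have "X * (R1 * X) + X * (X * R2) = 0\<^sub>m n n"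
    using X(1) R1(1) R2(1) by (simp flip: mult_add_distrib_mat[of _ n n _ n])
  then have "trace (X * (R1 * X)) + trace (X * (X * R2)) = 0"
    using X(1) R1(1) R2(1) trace_add[of "X * (R1 * X)" n "X * (X * R2)"]
    by (auto simp: trace_def)
  \<comment> \<open>Cyclic invariance moves \<open>R2\<close> between the two copies of the
    symmetric \<open>X\<close>, producing a congruence with nonnegative diagonal.\<close>
  also have "trace (X * (X * R2)) = trace (X * R2 * X)"
    using X(1) R2(1) by (intro trace_mult_comm) auto
  finally have "trace (X\<^sup>T * R1 * X) + trace (X\<^sup>T * R2 * X) = 0"
    using X R1(1) R2(1) by (simp add: assoc_mult_mat[of _ n n _ n _ n])
  then have sum0: "(\<Sum>i<n. (X\<^sup>T * R1 * X) $$ (i, i) + (X\<^sup>T * R2 * X) $$ (i, i)) = 0"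
    using X(1) by (simp add: trace_def sum.distrib)
  have "col X i = 0\<^sub>v n" if i: "i < n" for i
  proof -
    note nn = sym_pos_def_congruence_index_nonneg[OF R1(2,1) X(1)]
      sym_pos_def_congruence_index_nonneg[OF R2(2,1) X(1)]
    have "(X\<^sup>T * R1 * X) $$ (i, i) + (X\<^sup>T * R2 * X) $$ (i, i) = 0"
      using sum0 i nn(1,3) by (subst (asm) sum_nonneg_eq_0_iff) (simp_all add: add_nonneg_nonneg)
    then show ?thesis using nn[OF i] by auto
  qed
  then have "X $$ (i, j) = 0" if "i < n" "j < n" for i j
    using that X(1) by (metis carrier_matD index_col index_zero_vec(1))
  then show ?thesis
    using R1(1) R2(1) by (intro eq_matI) (auto simp: X_def)
qed

lemma mat_sqrt:
  assumes S: "S \<in> carrier_mat n n" and spd: "sym_pos_def S"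
  shows "mat_sqrt S \<in> carrier_mat n n" "sym_pos_def (mat_sqrt S)" "mat_sqrt S * mat_sqrt S = S"
proof -
  \<comment> \<open>The dimension of a root is forced by its square; uniqueness was shown for a
    fixed dimension only, while the description in \<open>mat_sqrt\<close> mentions none.\<close>
  have car: "R \<in> carrier_mat n n" if "sym_pos_def R" "R * R = S" for R
    using that(1) arg_cong[OF that(2), of dim_row] S by (auto simp: sym_pos_def_def intro!: carrier_matI)
  have "\<exists>!R. sym_pos_def R \<and> R * R = S"
    using sym_pos_def_sqrt_exists[OF S spd] sym_pos_def_sqrt_unique car by metis
  then have "sym_pos_def (mat_sqrt S) \<and> mat_sqrt S * mat_sqrt S = S"
    unfolding mat_sqrt_def by (rule theI')
  with car show "mat_sqrt S \<in> carrier_mat n n" "sym_pos_def (mat_sqrt S)" "mat_sqrt S * mat_sqrt S = S"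
    by auto
qed

text \<open>A positive definite form has trivial kernel, so the determinant is nonzero. The inverse
  \<open>Q\<close> inherits symmetry through
  \<open>Q\<^sup>T * (R * Q) = (R * Q)\<^sup>T * Q\<close>.\<close>

lemma sym_pos_def_mat_inverse:
  assumes R: "R \<in> carrier_mat n n" and spd: "sym_pos_def R"
  shows "the (mat_inverse R) \<in> carrier_mat n n" "R * the (mat_inverse R) = 1\<^sub>m n"
    "the (mat_inverse R) * R = 1\<^sub>m n" "(the (mat_inverse R))\<^sup>T = the (mat_inverse R)"
proof -
  have "det R \<noteq> 0"
    using spd R by (force simp: det_0_iff_vec_prod_zero[OF R] sym_pos_def_def)
  then have "mat_inverse R \<noteq> None"
    using mat_inverse(1)[OF R] det_non_zero_imp_unit[OF R] by metis
  then obtain Q where Q: "mat_inverse R = Some Q" by blast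
  from mat_inverse(2)[OF R Q] have i: "R * Q = 1\<^sub>m n" "Q * R = 1\<^sub>m n" "Q \<in> carrier_mat n n" by auto
  have "Q\<^sup>T = Q\<^sup>T * (R * Q)" using i by simp
  also have "\<dots> = (R * Q)\<^sup>T * Q"
    using R i(3) spd by (simp add: transpose_mult[of _ n n _ n] sym_pos_def_def assoc_mult_mat[of _ n n _ n _ n])
  also have "\<dots> = Q" using i by simp
  finally show "the (mat_inverse R) \<in> carrier_mat n n" "R * the (mat_inverse R) = 1\<^sub>m n"
    "the (mat_inverse R) * R = 1\<^sub>m n" "(the (mat_inverse R))\<^sup>T = the (mat_inverse R)"
    using i Q by auto
qed

section \<open>The norm of the skew part and the eigenvalues\<close>

text \<open>Transposition preserves the trace but, combined with cyclic invariance, also reverses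
  its sign here.\<close>

lemma trace_mult_symmetric_skew:
  fixes B M :: "real mat"
  assumes B: "B \<in> carrier_mat n n" "B\<^sup>T = B" and M: "M \<in> carrier_mat n n" "M\<^sup>T = - M"
  shows "trace (B * M) = 0"
proof -
  have "trace (B * M) = trace (B * M)\<^sup>T" using B M by (simp add: trace_transpose[of _ n])
  also have "(B * M)\<^sup>T = - (M * B)" using B M by (simp add: transpose_mult[of _ n n _ n])
  also have "trace \<dots> = - trace (B * M)"
    using B M by (simp add: trace_uminus[of _ n] trace_mult_comm[of M n n B])
  finally show ?thesis by simp
qed

lemma frobenius_norm_skew:
  assumes "M \<in> carrier_mat n n" "M\<^sup>T = - M"
  shows "(frobenius_norm M)\<^sup>2 = - trace (M * M)"
  using assms by (simp add: frobenius_norm_square[of _ n n] trace_uminus[of _ n])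

text \<open>The cross terms vanish by orthogonality, and the skew part enters with a minus sign
  because \<open>M * M = - (M\<^sup>T * M)\<close>.\<close>

lemma trace_square_symmetric_plus_skew:
  assumes B: "B \<in> carrier_mat n n" "B\<^sup>T = B" and M: "M \<in> carrier_mat n n" "M\<^sup>T = - M"
  shows "trace ((B + M) * (B + M)) = (frobenius_norm B)\<^sup>2 - (frobenius_norm M)\<^sup>2"
proof -
  have "(B + M) * (B + M) = (B * B + B * M) + (M * B + M * M)"
    using B(1) M(1) by (simp add: add_mult_distrib_mat[of _ n n _ _ n] mult_add_distrib_mat[of _ n n _ n])
       (auto intro!: eq_matI)
  then have "trace ((B + M) * (B + M))
      = trace (B * B) + trace (B * M) + (trace (M * B) + trace (M * M))"
    using B(1) M(1) by (simp add: trace_add[of _ n])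
  also have "trace (M * B) = 0"
    using trace_mult_symmetric_skew[OF B M] trace_mult_comm[OF M(1) B(1)] by simp
  finally show ?thesis
    using trace_mult_symmetric_skew[OF B M] frobenius_norm_skew[OF M]
      frobenius_norm_square[OF B(1)] B(2) by simp
qed

lemma frobenius_norm_orth:
  assumes U: "orth_mat n U" and A: "A \<in> carrier_mat n n"
  shows "frobenius_norm (U\<^sup>T * A * U) = frobenius_norm A"
proof -
  note Uc = orth_matD[OF U]
  have "(U\<^sup>T * A * U)\<^sup>T * (U\<^sup>T * A * U) = U\<^sup>T * (A\<^sup>T * A) * U"
    using Uc(1,2) A unfolding transpose_congruence[OF Uc(1) A]
    by (simp add: assoc_mult_mat[of _ n n _ n _ n] orth_mat_cancel(2)[OF U, of _ n])
  then have "(frobenius_norm (U\<^sup>T * A * U))\<^sup>2 = (frobenius_norm A)\<^sup>2"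
    using trace_similar[OF orth_similar[OF U, of "A\<^sup>T * A"]] Uc A
    by (simp add: frobenius_norm_square[of _ n n])
  then show ?thesis
    by (simp add: frobenius_norm_def sum_nonneg)
qed

text \<open>Both evaluations of the trace of the square of \<open>B + M\<close>, by parts and by
  eigenvalues, are compared. The sum of squared imaginary parts is the exact excess over the lower
  bound, so this identity yields both the bound and its equality case.\<close>

lemma frobenius_norm_skew_eigenvalues:
  assumes B: "B \<in> carrier_mat n n" "B\<^sup>T = B" and M: "M \<in> carrier_mat n n" "M\<^sup>T = - M"
    and re: "\<And>s. s \<in> cspectrum (B + M) \<Longrightarrow> Re s = g"
  obtains es where "length es = n" "set es = cspectrum (B + M)"
    "(frobenius_norm M)\<^sup>2 = (frobenius_norm B)\<^sup>2 - real n * g\<^sup>2 + (\<Sum>i<n. (Im (es ! i))\<^sup>2)"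
proof -
  let ?A = "B + M" and ?C = "map_mat complex_of_real (B + M)"
  have A: "?A \<in> carrier_mat n n" using B M by simp
  then have C: "?C \<in> carrier_mat n n" by simp
  from trace_square_eigenvalues[OF C] obtain es where
    len: "length es = n" and es: "set es = cspectrum ?A" and tr: "trace (?C * ?C) = (\<Sum>i<n. (es ! i)\<^sup>2)"
    unfolding cspectrum_def by metis
  have Re_es: "Re (es ! i) = g" if "i < n" for i using re es len that nth_mem by blast
  have "trace (?C * ?C) = complex_of_real (trace (?A * ?A))"
    using A M(1) by (simp add: trace_def of_real_hom.mat_hom_mult[OF A A, symmetric])
  then have "trace (?A * ?A) = Re (\<Sum>i<n. (es ! i)\<^sup>2)" using tr by (metis Re_complex_of_real)
  \<comment> \<open>The real part of a square is the square of the real part minus that of the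
    imaginary part.\<close>
  also have "\<dots> = (\<Sum>i<n. g\<^sup>2 - (Im (es ! i))\<^sup>2)"
    using Re_es by (auto simp: power2_eq_square intro!: sum.cong)
  also have "\<dots> = real n * g\<^sup>2 - (\<Sum>i<n. (Im (es ! i))\<^sup>2)" by (simp add: sum_subtractf)
  finally show thesis
    using that[OF len es] trace_square_symmetric_plus_skew[OF B M] by simp
qed

text \<open>In the equality case the excess is zero, so \<open>g\<close> is the only possible
  eigenvalue. The characteristic polynomial then splits over the reals, \<open>real_schur\<close>
  applies, and the diagonal of the triangular form consists of eigenvalues.\<close>

lemma skew_minimal_imp_triangular:
  assumes B: "B \<in> carrier_mat n n" "B\<^sup>T = B" and M: "M \<in> carrier_mat n n" "M\<^sup>T = - M"
    and re: "\<And>s. s \<in> cspectrum (B + M) \<Longrightarrow> Re s = g"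
    and le: "(frobenius_norm M)\<^sup>2 \<le> (frobenius_norm B)\<^sup>2 - real n * g\<^sup>2"
  obtains U where "orth_mat n U" "upper_triangular (U\<^sup>T * (B + M) * U)"
    "diag_mat (U\<^sup>T * (B + M) * U) = replicate n g"
proof -
  have A: "B + M \<in> carrier_mat n n" using B M by simp
  obtain es where len: "length es = n" and es: "set es = cspectrum (B + M)" and
    eq: "(frobenius_norm M)\<^sup>2 = (frobenius_norm B)\<^sup>2 - real n * g\<^sup>2 + (\<Sum>i<n. (Im (es ! i))\<^sup>2)"
    using frobenius_norm_skew_eigenvalues[OF B M re] by blast
  have "(\<Sum>i<n. (Im (es ! i))\<^sup>2) = 0"
    using eq le by (intro antisym sum_nonneg) auto
  then have "\<forall>s\<in>set es. Im s = 0"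
    using len by (simp add: sum_nonneg_eq_0_iff all_set_conv_all_nth)
  then have spec: "cspectrum (B + M) \<subseteq> {complex_of_real g}"
    using re es by (auto simp: complex_eq_iff)
  then obtain rs where "char_poly (B + M) = (\<Prod>e\<leftarrow>rs. [:- e, 1:])"
    using char_poly_real_factorized[OF A] by (metis Im_complex_of_real singletonD subsetD)
  from real_schur[OF A this] obtain U where
    U: "orth_mat n U" and ut: "upper_triangular (U\<^sup>T * (B + M) * U)" by blast
  define T where "T = U\<^sup>T * (B + M) * U"
  have T: "T \<in> carrier_mat n n" using orth_matD[OF U] A by (simp add: T_def)
  have "complex_of_real ` set (diag_mat T) \<subseteq> {complex_of_real g}"
    using spec cspectrum_similar[OF orth_similar[OF U A]]
      cspectrum_upper_triangular[OF T ut[folded T_def]] by (simp add: T_def)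
  then have "set (diag_mat T) \<subseteq> {g}" by auto
  then have "diag_mat T = replicate n g"
    using T by (intro replicate_eqI) (auto simp: diag_mat_def)
  then show thesis using that U ut by (simp add: T_def)
qed

section \<open>Skew-symmetric completion to a triangular matrix\<close>

lemma M_star_carrier: "S \<in> carrier_mat n n \<Longrightarrow> M_star S Psi \<in> carrier_mat n n"
  by (simp add: M_star_def Let_def)

lemma M_star_skew:
  assumes S: "S \<in> carrier_mat n n" "S\<^sup>T = S" and Psi: "Psi \<in> carrier_mat n n"
  shows "(M_star S Psi)\<^sup>T = - M_star S Psi"
proof -
  have B: "(Psi\<^sup>T * S * Psi)\<^sup>T = Psi\<^sup>T * S * Psi" using transpose_congruence[OF Psi S(1)] S(2) by simp
  have "(Psi\<^sup>T * S * Psi) $$ (i, j) = (Psi\<^sup>T * S * Psi) $$ (j, i)" if "i < n" "j < n" for i j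
    using arg_cong[OF B, of "\<lambda>X. X $$ (i, j)"] that S Psi by simp
  then show ?thesis
    using S Psi by (intro eq_matI) (auto simp: M_star_def Let_def)
qed

lemma M_star_triangular:
  assumes S: "S \<in> carrier_mat n n" and Psi: "Psi \<in> carrier_mat n n"
    and diag: "\<And>k. k < n \<Longrightarrow> (Psi\<^sup>T * S * Psi) $$ (k, k) = g"
  shows "upper_triangular (Psi\<^sup>T * S * Psi + M_star S Psi)"
    "diag_mat (Psi\<^sup>T * S * Psi + M_star S Psi) = replicate n g"
  using S Psi diag
  by (auto simp: M_star_def Let_def diag_mat_def intro!: upper_triangularI nth_equalityI)

text \<open>Triangularity prescribes \<open>M\<close> below the diagonal, and skewness then
  determines the diagonal and the upper half.\<close>

lemma M_star_unique:
  assumes S: "S \<in> carrier_mat n n" "S\<^sup>T = S" and Psi: "Psi \<in> carrier_mat n n"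
    and M: "M \<in> carrier_mat n n" "M\<^sup>T = - M" and ut: "upper_triangular (Psi\<^sup>T * S * Psi + M)"
  shows "M = M_star S Psi"
proof -
  define B where "B = Psi\<^sup>T * S * Psi"
  have Bc: "B \<in> carrier_mat n n" using S Psi by (simp add: B_def)
  have BT: "B\<^sup>T = B" using transpose_congruence[OF Psi S(1)] S(2) by (simp add: B_def)
  have B: "B $$ (i, j) = B $$ (j, i)" if "i < n" "j < n" for i j
    using arg_cong[OF BT, of "\<lambda>X. X $$ (i, j)"] that Bc by simp
  have Ms: "M $$ (j, i) = - M $$ (i, j)" if "i < n" "j < n" for i j
    using arg_cong[OF M(2), of "\<lambda>X. X $$ (i, j)"] that M(1) by simp
  have low: "M $$ (i, j) = - B $$ (i, j)" if "j < i" "i < n" for i j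
    using upper_triangularD[OF ut, folded B_def, of j i] that M(1) Bc by simp
  show ?thesis
  proof (rule eq_matI)
    fix i j assume "i < dim_row (M_star S Psi)" "j < dim_col (M_star S Psi)"
    then have ij: "i < n" "j < n" using M_star_carrier[OF S(1), of Psi] by auto
    then have "M_star S Psi $$ (i, j) = (if i < j then B $$ (i, j) else if i = j then 0 else - B $$ (i, j))"
      using S(1) by (simp add: M_star_def B_def Let_def)
    then show "M $$ (i, j) = M_star S Psi $$ (i, j)"
      using ij B[of i j] Ms[of i j] low[of j i] low[of i j] by (cases i j rule: linorder_cases) auto
  qed (use M_star_carrier[OF S(1), of Psi] M in auto)
qed

text \<open>The triangular matrix \<open>T\<close> has constant diagonal \<open>g\<close>, so the
  trace of its square is \<open>real n * g\<^sup>2\<close>; splitting the same trace into symmetric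
  and skew parts isolates the norm of \<open>M_star S Psi\<close>.\<close>

lemma frobenius_norm_M_star:
  assumes S: "S \<in> carrier_mat n n" "S\<^sup>T = S" and Psi: "orth_mat n Psi"
    and diag: "\<And>k. k < n \<Longrightarrow> (Psi\<^sup>T * S * Psi) $$ (k, k) = g"
  shows "(frobenius_norm (M_star S Psi))\<^sup>2 = (frobenius_norm S)\<^sup>2 - real n * g\<^sup>2"
proof -
  note P = orth_matD(1,2)[OF Psi]
  let ?B = "Psi\<^sup>T * S * Psi" and ?M = "M_star S Psi"
  have B: "?B \<in> carrier_mat n n" "?B\<^sup>T = ?B"
    using S P transpose_congruence[OF P(1) S(1)] by auto
  have M: "?M \<in> carrier_mat n n" "?M\<^sup>T = - ?M"
    using M_star_carrier[OF S(1)] M_star_skew[OF S P(1)] by auto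
  note T = M_star_triangular[OF S(1) P(1) diag]
  define T where "T = ?B + ?M"
  have Tc: "T \<in> carrier_mat n n" using B M by (simp add: T_def)
  have "T $$ (i, i) = g" if "i < n" for i
    using arg_cong[OF T(2), of "\<lambda>xs. xs ! i"] that Tc by (simp add: diag_mat_def flip: T_def)
  then have "trace (T * T) = real n * g\<^sup>2"
    using Tc upper_triangular_square_diag[OF Tc T(1)[folded T_def]] by (simp add: trace_def)
  then show ?thesis
    using trace_square_symmetric_plus_skew[OF B M] frobenius_norm_orth[OF Psi S(1)]
    by (simp add: T_def)
qed

section \<open>Equalizing the diagonal by plane rotations\<close>

text \<open>With \<open>x = cos t\<close> and \<open>y = sin t\<close> the form takes the value
  \<open>a\<close> at 0 and \<open>c\<close> at a right angle; the intermediate value theorem finds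
  \<open>g\<close> in between.\<close>

lemma rotation_value_exists:
  fixes a b c g :: real
  assumes "a \<le> g" "g \<le> c"
  obtains x y where "x\<^sup>2 + y\<^sup>2 = 1" "a * x\<^sup>2 + 2 * b * (x * y) + c * y\<^sup>2 = g"
proof -
  let ?f = "\<lambda>t. a * (cos t)\<^sup>2 + 2 * b * (cos t * sin t) + c * (sin t)\<^sup>2"
  have "\<exists>t. 0 \<le> t \<and> t \<le> pi / 2 \<and> ?f t = g"
    using assms by (intro IVT') (auto intro!: continuous_intros)
  then show thesis using that by (metis sin_cos_squared_add2)
qed

text \<open>A rotation in the plane of coordinates \<open>p\<close> and \<open>q\<close>, with
  \<open>x\<close> as cosine and \<open>y\<close> as sine. It is given by columns because
  \<open>congruence_index\<close> evaluates the form at columns.\<close>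

definition givens :: "nat \<Rightarrow> nat \<Rightarrow> nat \<Rightarrow> real \<Rightarrow> real \<Rightarrow> real mat" where
  "givens n p q x y = mat_of_cols n (map (\<lambda>k.
     if k = p then x \<cdot>\<^sub>v unit_vec n p + y \<cdot>\<^sub>v unit_vec n q
     else if k = q then (- y) \<cdot>\<^sub>v unit_vec n p + x \<cdot>\<^sub>v unit_vec n q
     else unit_vec n k) [0..<n])"

lemma givens_carrier: "givens n p q x y \<in> carrier_mat n n"
  by (rule carrier_matI) (simp_all add: givens_def)

lemma givens_col:
  assumes "k < n"
  shows "col (givens n p q x y) k =
    (if k = p then x \<cdot>\<^sub>v unit_vec n p + y \<cdot>\<^sub>v unit_vec n q
     else if k = q then (- y) \<cdot>\<^sub>v unit_vec n p + x \<cdot>\<^sub>v unit_vec n q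
     else unit_vec n k)"
  using assms by (simp add: givens_def)

lemma scalar_prod_two_units:
  fixes v :: "real vec"
  assumes "v \<in> carrier_vec n" "p < n" "q < n"
  shows "(a \<cdot>\<^sub>v unit_vec n p + b \<cdot>\<^sub>v unit_vec n q) \<bullet> v = a * v $ p + b * v $ q"
  using assms
  by (simp add: add_scalar_prod_distrib[of _ n] smult_scalar_prod_distrib[of _ n])

lemma orth_mat_givens:
  assumes "p < n" "q < n" "p \<noteq> q" and xy: "x\<^sup>2 + y\<^sup>2 = 1"
  shows "orth_mat n (givens n p q x y)"
proof -
  let ?G = "givens n p q x y"
  note G = givens_carrier[of n p q x y]
  have "?G\<^sup>T * ?G = 1\<^sub>m n"
  proof (rule eq_matI)
    fix i j assume "i < dim_row (1\<^sub>m n :: real mat)" "j < dim_col (1\<^sub>m n :: real mat)"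
    then have ij: "i < n" "j < n" by auto
    then have "(?G\<^sup>T * ?G) $$ (i, j) = col ?G i \<bullet> col ?G j" using G by simp
    also have "\<dots> = (if i = p then x * col ?G j $ p + y * col ?G j $ q
        else if i = q then - y * col ?G j $ p + x * col ?G j $ q else col ?G j $ i)"
      using ij(1) assms(1,2) col_carrier_vec[OF ij(2) G]
      by (simp only: givens_col[OF ij(1)] scalar_prod_two_units scalar_prod_left_unit split: if_split)
        simp
    also have "\<dots> = 1\<^sub>m n $$ (i, j)"
      unfolding givens_col[OF ij(2)] using ij assms(1-3) xy
      by (simp add: power2_eq_square mult.commute)
    finally show "(?G\<^sup>T * ?G) $$ (i, j) = 1\<^sub>m n $$ (i, j)" .
  qed (use G in auto)
  with G show ?thesis by (simp add: orth_mat_def)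
qed

text \<open>Only columns \<open>p\<close> and \<open>q\<close> differ from unit vectors. The new
  entry at \<open>q\<close> is left unspecified, since the induction below tolerates any value
  there.\<close>

lemma givens_congruence:
  assumes B: "B \<in> carrier_mat n n" "B\<^sup>T = B" and pq: "p < n" "q < n" "p \<noteq> q"
  shows "((givens n p q x y)\<^sup>T * B * givens n p q x y) $$ (p, p)
      = B $$ (p, p) * x\<^sup>2 + 2 * B $$ (p, q) * (x * y) + B $$ (q, q) * y\<^sup>2"
    and "\<And>k. k < n \<Longrightarrow> k \<noteq> p \<Longrightarrow> k \<noteq> q \<Longrightarrow>
      ((givens n p q x y)\<^sup>T * B * givens n p q x y) $$ (k, k) = B $$ (k, k)"
proof -
  note G = givens_carrier[of n p q x y]
  have e: "unit_vec n i \<bullet> (B *\<^sub>v unit_vec n j) = B $$ (i, j)" if "i < n" "j < n" for i j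
    using that B(1) by simp
  have sym: "B $$ (q, p) = B $$ (p, q)"
    using arg_cong[OF B(2), of "\<lambda>X. X $$ (p, q)"] pq B(1) by simp
  have ident: "x * (x * a + y * b) + y * (x * b + y * c) = a * x\<^sup>2 + 2 * b * (x * y) + c * y\<^sup>2"
    for a b c by (simp add: power2_eq_square algebra_simps)
  let ?u = "x \<cdot>\<^sub>v unit_vec n p + y \<cdot>\<^sub>v unit_vec n q"
  have idx: "(B *\<^sub>v ?u) $ i = x * B $$ (i, p) + y * B $$ (i, q)" if "i < n" for i
  proof -
    have r: "row B i \<in> carrier_vec n" using B(1) that by simp
    have "(B *\<^sub>v ?u) $ i = row B i \<bullet> ?u" using B(1) that by (intro index_mult_mat_vec) auto
    also have "\<dots> = ?u \<bullet> row B i" by (rule comm_scalar_prod[OF r]) simp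
    also have "\<dots> = x * row B i $ p + y * row B i $ q"
      by (rule scalar_prod_two_units[OF r pq(1,2)])
    finally show ?thesis using B(1) that pq by simp
  qed
  have "col (givens n p q x y) p = ?u" using givens_col[OF pq(1)] by simp
  then have "((givens n p q x y)\<^sup>T * B * givens n p q x y) $$ (p, p) = ?u \<bullet> (B *\<^sub>v ?u)"
    using congruence_index[OF B(1) G pq(1) pq(1)] by (simp only:)
  also have "\<dots> = x * (B *\<^sub>v ?u) $ p + y * (B *\<^sub>v ?u) $ q"
    using B(1) by (intro scalar_prod_two_units[OF _ pq(1,2)] mult_mat_vec_carrier) auto
  also have "\<dots> = x * (x * B $$ (p, p) + y * B $$ (p, q)) + y * (x * B $$ (p, q) + y * B $$ (q, q))"
    by (simp only: idx[OF pq(1)] idx[OF pq(2)] sym)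
  also have "\<dots> = B $$ (p, p) * x\<^sup>2 + 2 * B $$ (p, q) * (x * y) + B $$ (q, q) * y\<^sup>2"
    by (rule ident)
  finally show "((givens n p q x y)\<^sup>T * B * givens n p q x y) $$ (p, p)
      = B $$ (p, p) * x\<^sup>2 + 2 * B $$ (p, q) * (x * y) + B $$ (q, q) * y\<^sup>2" .
  show "((givens n p q x y)\<^sup>T * B * givens n p q x y) $$ (k, k) = B $$ (k, k)"
    if "k < n" "k \<noteq> p" "k \<noteq> q" for k
  proof -
    have "col (givens n p q x y) k = unit_vec n k" using givens_col[OF that(1)] that by simp
    then show ?thesis using congruence_index[OF B(1) G that(1) that(1)] e[OF that(1) that(1)] by (simp only:)
  qed
qed

text \<open>Induction on the number of diagonal entries different from \<open>g\<close>. As their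
  mean is \<open>g\<close>, a wrong entry forces one entry below and one above; a rotation in their
  plane corrects the entry at \<open>p\<close> and creates no new wrong one.\<close>

lemma equal_diagonal_exists:
  fixes B :: "real mat"
  assumes "B \<in> carrier_mat n n" "B\<^sup>T = B" "trace B = real n * g"
  shows "\<exists>U. orth_mat n U \<and> (\<forall>k<n. (U\<^sup>T * B * U) $$ (k, k) = g)"
  using assms
proof (induction "card {k. k < n \<and> B $$ (k, k) \<noteq> g}" arbitrary: B rule: less_induct)
  case less
  note B = less.prems
  have tr: "(\<Sum>k<n. B $$ (k, k)) = (\<Sum>k<n. g)" using B by (auto simp: trace_def)
  show ?case
  proof (cases "\<exists>k<n. B $$ (k, k) \<noteq> g")
    case False
    then show ?thesis using B(1) by (intro exI[of _ "1\<^sub>m n"]) (simp add: orth_mat_one)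
  next
    case True
    have "\<exists>p<n. B $$ (p, p) < g"
    proof (rule ccontr)
      assume "\<not> ?thesis"
      then have le: "g \<le> B $$ (k, k)" if "k < n" for k using that not_less by blast
      then obtain k where "k < n" "g < B $$ (k, k)" using True by (auto simp: order_le_less)
      with le have "(\<Sum>k<n. g) < (\<Sum>k<n. B $$ (k, k))"
        by (intro sum_strict_mono_ex1) auto
      with tr show False by simp
    qed
    then obtain p where p: "p < n" "B $$ (p, p) < g" by blast
    have "\<exists>q<n. B $$ (q, q) > g"
    proof (rule ccontr)
      assume "\<not> ?thesis"
      then have "B $$ (k, k) \<le> g" if "k < n" for k using that not_less by blast
      then have "(\<Sum>k<n. B $$ (k, k)) < (\<Sum>k<n. g)"
        using p by (intro sum_strict_mono_ex1) auto
      with tr show False by simp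
    qed
    then obtain q where q: "q < n" "B $$ (q, q) > g" by blast
    have pq: "p \<noteq> q" using p q by auto
    obtain x y where xy: "x\<^sup>2 + y\<^sup>2 = 1"
      "B $$ (p, p) * x\<^sup>2 + 2 * B $$ (p, q) * (x * y) + B $$ (q, q) * y\<^sup>2 = g"
      using rotation_value_exists[of "B $$ (p, p)" g "B $$ (q, q)" "B $$ (p, q)"] p q by auto
    define G where "G = givens n p q x y"
    have G: "orth_mat n G" using orth_mat_givens[OF p(1) q(1) pq xy(1)] by (simp add: G_def)
    note Gc = orth_matD[OF G]
    define B' where "B' = G\<^sup>T * B * G"
    have B': "B' \<in> carrier_mat n n" "B'\<^sup>T = B'" "trace B' = real n * g"
      using B Gc transpose_congruence[OF Gc(1) B(1)] trace_similar[OF orth_similar[OF G B(1)]]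
      by (auto simp: B'_def)
    have "{k. k < n \<and> B' $$ (k, k) \<noteq> g} \<subset> {k. k < n \<and> B $$ (k, k) \<noteq> g}"
    proof
      show "{k. k < n \<and> B' $$ (k, k) \<noteq> g} \<subseteq> {k. k < n \<and> B $$ (k, k) \<noteq> g}"
      proof
        fix k assume k: "k \<in> {k. k < n \<and> B' $$ (k, k) \<noteq> g}"
        then have "k \<noteq> p" using givens_congruence(1)[OF B(1,2) p(1) q(1) pq] xy(2) by (auto simp: B'_def G_def)
        \<comment> \<open>The case \<open>k = q\<close> is harmless: the entry at \<open>q\<close>
          was already wrong before the rotation.\<close>
        with k show "k \<in> {k. k < n \<and> B $$ (k, k) \<noteq> g}"
          using givens_congruence(2)[OF B(1,2) p(1) q(1) pq, of k x y] q
          by (cases "k = q") (auto simp: B'_def G_def)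
      qed
      have "p \<notin> {k. k < n \<and> B' $$ (k, k) \<noteq> g}"
        using givens_congruence(1)[OF B(1,2) p(1) q(1) pq] xy(2) by (auto simp: B'_def G_def)
      moreover have "p \<in> {k. k < n \<and> B $$ (k, k) \<noteq> g}" using p by simp
      ultimately show "{k. k < n \<and> B' $$ (k, k) \<noteq> g} \<noteq> {k. k < n \<and> B $$ (k, k) \<noteq> g}"
        by metis
    qed
    then have "card {k. k < n \<and> B' $$ (k, k) \<noteq> g} < card {k. k < n \<and> B $$ (k, k) \<noteq> g}"
      by (intro psubset_card_mono) auto
    from less.hyps[OF this B'] obtain U where
      U: "orth_mat n U" "\<forall>k<n. (U\<^sup>T * B' * U) $$ (k, k) = g" by blast
    have "U\<^sup>T * B' * U = (G * U)\<^sup>T * B * (G * U)"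
      using B(1) Gc(1,2) orth_matD(1,2)[OF U(1)]
      by (simp add: B'_def transpose_mult[of _ n n _ n] assoc_mult_mat[of _ n n _ n _ n])
    then show ?thesis using U orth_mat_mult[OF G U(1)] by auto
  qed
qed

section \<open>Optimal skew perturbations\<close>

lemma equalizing_basis_iff:
  assumes S: "S \<in> carrier_mat n n"
  shows "equalizing_basis S Psi \<longleftrightarrow>
    orth_mat n Psi \<and> (\<forall>k<n. (Psi\<^sup>T * S * Psi) $$ (k, k) = gamma_star S)"
proof -
  have "dim_row S = n" using S by simp
  then show ?thesis unfolding equalizing_basis_def orth_mat_def
    using congruence_index[OF S, of Psi] by auto
qed

lemma diag_mat_eq_replicate:
  "A \<in> carrier_mat n n \<Longrightarrow> diag_mat A = replicate n g \<longleftrightarrow> (\<forall>k<n. A $$ (k, k) = g)"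
  unfolding map_replicate_trivial[symmetric] by (auto simp: diag_mat_def)

lemma equalizing_basis_iff_diag_mat:
  assumes S: "S \<in> carrier_mat n n"
  shows "equalizing_basis S Psi \<longleftrightarrow> Psi \<in> carrier_mat n n \<and> Psi\<^sup>T * Psi = 1\<^sub>m n \<and>
    diag_mat (Psi\<^sup>T * S * Psi) = replicate n (gamma_star S)"
  unfolding equalizing_basis_iff[OF S] orth_mat_def
  using diag_mat_eq_replicate[of "Psi\<^sup>T * S * Psi" n] S by auto

lemma equalizing_basis_exists:
  assumes "n > 0" "S \<in> carrier_mat n n" "S\<^sup>T = S"
  shows "\<exists>Psi. equalizing_basis S Psi"
proof -
  have "trace S = real n * gamma_star S"
    using assms by (auto simp: gamma_star_def mat_trace_eq_trace)
  from equal_diagonal_exists[OF assms(2,3) this] show ?thesis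
    unfolding equalizing_basis_iff[OF assms(2)] .
qed

lemma mat_inv_sqrt:
  assumes "S \<in> carrier_mat n n" "sym_pos_def S"
  shows "mat_inv_sqrt S \<in> carrier_mat n n" "mat_sqrt S * mat_inv_sqrt S = 1\<^sub>m n"
    "mat_inv_sqrt S * mat_sqrt S = 1\<^sub>m n" "(mat_inv_sqrt S)\<^sup>T = mat_inv_sqrt S"
  unfolding mat_inv_sqrt_def using sym_pos_def_mat_inverse[OF mat_sqrt(1,2)[OF assms]] by auto

section \<open>Reduction of (P1) to a skew-symmetric perturbation of \<open>S\<close>\<close>

lemma skew_congruence:
  fixes X M :: "real mat"
  assumes "X \<in> carrier_mat n n" "M \<in> carrier_mat n n" "M\<^sup>T = - M"
  shows "(X\<^sup>T * M * X)\<^sup>T = - (X\<^sup>T * M * X)"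
  unfolding transpose_congruence[OF assms(1,2)] assms(3) using assms(1,2) by simp

text \<open>Since \<open>S\<close> is the square of its root, conjugation by the root carries
  \<open>(1\<^sub>m n + J) * S\<close> to \<open>S + K\<close>, and cyclic invariance turns the
  objective into the norm of \<open>K\<close>. The last equation recovers \<open>J\<close>, so no
  information is lost.\<close>

lemma P1_substitution:
  assumes S: "S \<in> carrier_mat n n" "sym_pos_def S" and J: "J \<in> carrier_mat n n" "J\<^sup>T = - J"
  defines "K \<equiv> mat_sqrt S * J * mat_sqrt S"
  shows "K \<in> carrier_mat n n" "K\<^sup>T = - K"
    "similar_mat ((1\<^sub>m n + J) * S) (S + K)" "P1_objective S J = (frobenius_norm K)\<^sup>2"
    "J = mat_inv_sqrt S * K * mat_inv_sqrt S"
proof -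
  define R Q where "R = mat_sqrt S" and "Q = mat_inv_sqrt S"
  note R = mat_sqrt[OF S, folded R_def]
  note Q = mat_inv_sqrt[OF S, folded R_def Q_def]
  note assoc = assoc_mult_mat[of _ n n _ n _ n]
  have RT: "R\<^sup>T = R" using R by (simp add: sym_pos_def_def)
  have K: "K = R * J * R" by (simp add: K_def R_def)
  show Kc: "K \<in> carrier_mat n n" using R J by (simp add: K)
  show KT: "K\<^sup>T = - K" using skew_congruence[OF R(1) J] by (simp add: K RT)
  have cancel: "R * (Q * X) = X" "Q * (R * X) = X" if "X \<in> carrier_mat n n" for X
    using that R(1) Q by (simp_all flip: assoc)
  have J1: "1\<^sub>m n + J \<in> carrier_mat n n" using J by simp
  have "S + K = R * (1\<^sub>m n + J) * R"
    using R(1,3) J by (simp add: K mult_add_distrib_mat[of _ n n _ n] add_mult_distrib_mat[of _ n n _ _ n])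
  then have "Q * (S + K) * R = (1\<^sub>m n + J) * (R * R)"
    using R(1) Q(1) J1 by (simp add: assoc cancel mult_carrier_mat[of _ n n _ n] del: add_carrier_mat)
  then have eq: "(1\<^sub>m n + J) * S = Q * (S + K) * R" by (simp only: R(3))
  show "similar_mat ((1\<^sub>m n + J) * S) (S + K)"
    by (rule similar_matI[OF _ Q(3,2) eq]) (use S(1) J1 Kc R(1) Q(1) in simp)
  have "trace (J * S * J * S) = trace (J * R * (R * J * R * R))"
    unfolding R(3)[symmetric] using R(1) J by (simp add: assoc)
  also have "\<dots> = trace (R * J * R * R * (J * R))"
    using R(1) J by (intro trace_mult_comm) auto
  also have "\<dots> = trace (K * K)" using R(1) J by (simp add: K assoc)
  finally have tr: "trace (J * S * J * S) = trace (K * K)" .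
  have c: "J * S * J * S \<in> carrier_mat n n" and neg: "- J * S * J * S = - (J * S * J * S)"
    using S(1) J(1) by auto
  show "P1_objective S J = (frobenius_norm K)\<^sup>2"
    unfolding P1_objective_def mat_trace_eq_trace neg trace_uminus[OF c] tr frobenius_norm_skew[OF Kc KT] ..
  show "J = mat_inv_sqrt S * K * mat_inv_sqrt S"
    using R(1) Q J by (simp add: K assoc cancel flip: Q_def)
qed

lemma P1_feasibleD:
  assumes S: "S \<in> carrier_mat n n" "sym_pos_def S" and J: "J \<in> P1_feasible S"
  shows "J \<in> carrier_mat n n" "J\<^sup>T = - J"
    "\<And>s. s \<in> cspectrum (S + mat_sqrt S * J * mat_sqrt S) \<Longrightarrow> Re s = gamma_star S"
proof -
  show Jc: "J \<in> carrier_mat n n" and JT: "J\<^sup>T = - J"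
    using J S(1) by (auto simp: P1_feasible_def) (metis uminus_uminus_mat)
  show "Re s = gamma_star S" if "s \<in> cspectrum (S + mat_sqrt S * J * mat_sqrt S)" for s
    using that J S(1) cspectrum_similar[OF P1_substitution(3)[OF S Jc JT]]
    by (auto simp: P1_feasible_def)
qed

lemma P1_lower_bound:
  assumes S: "S \<in> carrier_mat n n" "sym_pos_def S" and J: "J \<in> P1_feasible S"
  shows "(frobenius_norm S)\<^sup>2 - real n * (gamma_star S)\<^sup>2 \<le> P1_objective S J"
proof -
  have ST: "S\<^sup>T = S" using S by (simp add: sym_pos_def_def)
  note J' = P1_feasibleD[OF S J]
  note K = P1_substitution[OF S J'(1,2)]
  show ?thesis
    by (rule frobenius_norm_skew_eigenvalues[OF S(1) ST K(1,2) J'(3)])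
      (simp_all add: K(4) sum_nonneg)
qed

text \<open>Equality in the bound triangularizes \<open>S + K\<close> by an orthogonal
  \<open>U\<close>. In the basis \<open>U\<close> the skew part must be \<open>M_star S U\<close> by
  uniqueness; undoing both conjugations expresses \<open>J\<close>.\<close>

lemma P1_optimal_imp_J_star:
  assumes S: "S \<in> carrier_mat n n" "sym_pos_def S" and J: "J \<in> P1_feasible S"
    and le: "P1_objective S J \<le> (frobenius_norm S)\<^sup>2 - real n * (gamma_star S)\<^sup>2"
  shows "\<exists>Psi. equalizing_basis S Psi \<and> J = J_star S Psi"
proof -
  have ST: "S\<^sup>T = S" using S by (simp add: sym_pos_def_def)
  note J' = P1_feasibleD[OF S J]
  define K where "K = mat_sqrt S * J * mat_sqrt S"
  note K = P1_substitution[OF S J'(1,2), folded K_def]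
  obtain U where U: "orth_mat n U" and ut: "upper_triangular (U\<^sup>T * (S + K) * U)"
    and dg: "diag_mat (U\<^sup>T * (S + K) * U) = replicate n (gamma_star S)"
    using skew_minimal_imp_triangular[OF S(1) ST K(1,2) J'(3)[folded K_def] le[unfolded K(4)]] .
  note Uc = orth_matD[OF U]
  define M where "M = U\<^sup>T * K * U"
  have M: "M \<in> carrier_mat n n" "M\<^sup>T = - M"
    using Uc K(1) skew_congruence[OF Uc(1) K(1,2)] by (auto simp: M_def)
  have T: "U\<^sup>T * (S + K) * U = U\<^sup>T * S * U + M"
    using Uc S(1) K(1) by (simp add: M_def mult_add_distrib_mat[of _ n n _ n] add_mult_distrib_mat[of _ n n _ _ n])
  have M_eq: "M = M_star S U"
    using M_star_unique[OF S(1) ST Uc(1) M] ut by (simp add: T)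
  have "(U\<^sup>T * S * U) $$ (k, k) = gamma_star S" if "k < n" for k
  proof -
    \<comment> \<open>The skew part contributes nothing to the diagonal, so the constant diagonal of
      the triangular form belongs to \<open>U\<^sup>T * S * U\<close> alone.\<close>
    have "M $$ (k, k) = 0"
      using that S(1) by (simp add: M_eq M_star_def Let_def)
    then show ?thesis
      using arg_cong[OF dg, of "\<lambda>xs. xs ! k"] that M(1) by (simp add: T diag_mat_def)
  qed
  then have "equalizing_basis S U" using U by (simp add: equalizing_basis_iff[OF S(1)])
  moreover have "K = U * M * U\<^sup>T"
    using Uc(1,2,4) K(1) by (simp add: M_def assoc_mult_mat[of _ n n _ n _ n] orth_mat_cancel(2)[OF U, of _ n])
  then have "J = J_star S U" using K(5) by (simp add: J_star_def M_eq)
  ultimately show ?thesis by blast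
qed

text \<open>The triangular matrix \<open>B + M\<close> has \<open>gamma_star S\<close> as its only
  eigenvalue, and \<open>(1\<^sub>m n + J) * S\<close> is similar to it through
  \<open>S + N\<close>. Positivity of \<open>n\<close> makes the spectrum nonempty, so
  \<open>Min\<close> in \<open>J_s\<close> is taken over a singleton.\<close>

lemma J_star_optimal:
  assumes S: "S \<in> carrier_mat n n" "sym_pos_def S" and n: "n > 0" and Psi: "equalizing_basis S Psi"
  shows "(Psi, M_star S Psi) \<in> P2_feasible S" "J_star S Psi \<in> P1_feasible S" "J_star S Psi \<in> J_s S"
    "P1_objective S (J_star S Psi) = (frobenius_norm S)\<^sup>2 - real n * (gamma_star S)\<^sup>2"
proof -
  have ST: "S\<^sup>T = S" using S by (simp add: sym_pos_def_def)
  have P: "orth_mat n Psi" and diag: "\<And>k. k < n \<Longrightarrow> (Psi\<^sup>T * S * Psi) $$ (k, k) = gamma_star S"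
    using Psi by (auto simp: equalizing_basis_iff[OF S(1)])
  note Pc = orth_matD[OF P]
  define R Q M where "R = mat_sqrt S" and "Q = mat_inv_sqrt S" and "M = M_star S Psi"
  note R = mat_sqrt[OF S, folded R_def]
  note Q = mat_inv_sqrt[OF S, folded R_def Q_def]
  note assoc = assoc_mult_mat[of _ n n _ n _ n]
  have M: "M \<in> carrier_mat n n" "M\<^sup>T = - M"
    using M_star_carrier[OF S(1)] M_star_skew[OF S(1) ST Pc(1)] by (auto simp: M_def)
  define B where "B = Psi\<^sup>T * S * Psi"
  have B: "B \<in> carrier_mat n n" using Pc S by (simp add: B_def)
  have BM: "B + M \<in> carrier_mat n n" using B M by simp
  have spec: "cspectrum (B + M) = {complex_of_real (gamma_star S)}"
    using M_star_triangular[OF S(1) Pc(1) diag, folded M_def B_def] cspectrum_upper_triangular[OF BM] n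
    by simp
  then show "(Psi, M_star S Psi) \<in> P2_feasible S"
    using Pc M S(1) by (simp add: P2_feasible_def flip: M_def B_def)
  define N where "N = Psi * M * Psi\<^sup>T"
  have PT: "orth_mat n Psi\<^sup>T" using Pc by (simp add: orth_mat_def)
  have N: "N \<in> carrier_mat n n" "N\<^sup>T = - N"
    using Pc M skew_congruence[OF Pc(2) M] by (auto simp: N_def)
  define J where "J = Q * N * Q"
  have J_eq: "J = J_star S Psi" by (simp add: J_def J_star_def N_def Q_def M_def)
  have J: "J \<in> carrier_mat n n" "J\<^sup>T = - J"
    using Q N skew_congruence[OF Q(1) N] by (auto simp: J_def)
  have cancel: "R * (Q * X) = X" "Q * (R * X) = X" if "X \<in> carrier_mat n n" for X
    using that R(1) Q by (simp_all flip: assoc)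
  have K: "mat_sqrt S * J * mat_sqrt S = N"
    using R(1) Q N by (simp add: J_def assoc cancel flip: R_def)
  note sub = P1_substitution[OF S J, unfolded K]
  have "S + N = Psi * (B + M) * Psi\<^sup>T"
    using Pc S(1) M B
    by (simp add: N_def B_def mult_add_distrib_mat[of _ n n _ n] add_mult_distrib_mat[of _ n n _ _ n]
      assoc orth_mat_cancel(2)[OF P, of _ n])
  then have "similar_mat (S + N) (B + M)"
    using orth_similar[OF PT BM] by simp
  then have specJ: "cspectrum ((1\<^sub>m n + J) * S) = {complex_of_real (gamma_star S)}"
    using spec cspectrum_similar[OF sub(3)] cspectrum_similar by metis
  have dimS: "dim_row S = n" using S by simp
  show "J_star S Psi \<in> P1_feasible S"
    using specJ J by (simp add: P1_feasible_def dimS flip: J_eq)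
  show "J_star S Psi \<in> J_s S"
    using specJ J by (simp add: J_s_def dimS gamma_star_def flip: J_eq)
  have "P1_objective S J = (frobenius_norm M)\<^sup>2"
    using frobenius_norm_orth[OF PT M(1)] by (simp add: sub(4) N_def)
  then show "P1_objective S (J_star S Psi) = (frobenius_norm S)\<^sup>2 - real n * (gamma_star S)\<^sup>2"
    using frobenius_norm_M_star[OF S(1) ST P diag] by (simp add: M_def J_eq)
qed

text \<open>The eigenvalue identity applies directly to \<open>Psi\<^sup>T * S * Psi\<close>, whose
  Frobenius norm equals that of \<open>S\<close>.\<close>

lemma P2_lower_bound:
  assumes S: "S \<in> carrier_mat n n" "S\<^sup>T = S" and f: "x \<in> P2_feasible S"
  shows "(frobenius_norm S)\<^sup>2 - real n * (gamma_star S)\<^sup>2 \<le> P2_objective x"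
proof -
  obtain Psi M where x: "x = (Psi, M)" by force
  have dimS: "dim_row S = n" using S by simp
  have P: "orth_mat n Psi" and M: "M \<in> carrier_mat n n" "M\<^sup>T = - M"
    and re: "\<And>s. s \<in> cspectrum (Psi\<^sup>T * S * Psi + M) \<Longrightarrow> Re s = gamma_star S"
    using f by (auto simp: x P2_feasible_def orth_mat_def dimS)
  note Pc = orth_matD[OF P]
  have B: "Psi\<^sup>T * S * Psi \<in> carrier_mat n n" "(Psi\<^sup>T * S * Psi)\<^sup>T = Psi\<^sup>T * S * Psi"
    using Pc S transpose_congruence[OF Pc(1) S(1)] by auto
  show ?thesis
    by (rule frobenius_norm_skew_eigenvalues[OF B M re])
      (simp_all add: x P2_objective_def frobenius_norm_orth[OF P S(1)] sum_nonneg)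
qed

theorem theorem4:
  fixes S :: "real mat" and d :: nat
  assumes "d > 0" and "S \<in> carrier_mat d d" and "sym_pos_def S"
  shows "(\<exists>Psi. equalizing_basis S Psi) \<and>
    (\<forall>Psi. equalizing_basis S Psi \<longrightarrow>
       (\<forall>M \<in> carrier_mat d d. M\<^sup>T = - M \<longrightarrow>
          (M = M_star S Psi \<longleftrightarrow>
             upper_triangular (Psi\<^sup>T * S * Psi + M) \<and>
             diag_mat (Psi\<^sup>T * S * Psi + M) = replicate d (gamma_star S))) \<and>
       (M_star S Psi)\<^sup>T = - M_star S Psi \<and>
       (Psi, M_star S Psi) \<in> P2_feasible S \<and>
       J_star S Psi \<in> J_s S \<and>
       is_min_value P2_objective (P2_feasible S)
         (mat_trace (- J_star S Psi * S * J_star S Psi * S)) \<and>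
       is_min_value (P1_objective S) (P1_feasible S)
         (mat_trace (- J_star S Psi * S * J_star S Psi * S)) \<and>
       mat_trace (- J_star S Psi * S * J_star S Psi * S)
         = (frobenius_norm S)\<^sup>2 - real d * (gamma_star S)\<^sup>2 \<and>
       (frobenius_norm S)\<^sup>2 - real d * (gamma_star S)\<^sup>2
         = (frobenius_norm S)\<^sup>2 - (mat_trace S)\<^sup>2 / real d) \<and>
    global_minimizers (P1_objective S) (P1_feasible S) =
      {mat_inv_sqrt S * Psi * M_star S Psi * Psi\<^sup>T * mat_inv_sqrt S | Psi.
         Psi \<in> carrier_mat d d \<and> Psi\<^sup>T * Psi = 1\<^sub>m d \<and>
         diag_mat (Psi\<^sup>T * S * Psi) = replicate d (gamma_star S)}"
proof -
  note S = assms(2,3)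
  define m where "m = (frobenius_norm S)\<^sup>2 - real d * (gamma_star S)\<^sup>2"
  have ST: "S\<^sup>T = S" using S by (simp add: sym_pos_def_def)
  have m: "m = (frobenius_norm S)\<^sup>2 - (mat_trace S)\<^sup>2 / real d"
    using assms(1) S(1) by (simp add: m_def gamma_star_def power2_eq_square)
  note opt = J_star_optimal[OF S assms(1), folded m_def]
  note lower = P1_lower_bound[OF S, folded m_def]
  have tr: "mat_trace (- J_star S Psi * S * J_star S Psi * S) = m" if "equalizing_basis S Psi" for Psi
    using opt(4)[OF that] by (simp add: P1_objective_def)
  obtain Psi0 where Psi0: "equalizing_basis S Psi0"
    using equalizing_basis_exists[OF assms(1) S(1) ST] by blast
  have part: "(\<forall>M \<in> carrier_mat d d. M\<^sup>T = - M \<longrightarrow>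
          (M = M_star S Psi \<longleftrightarrow>
             upper_triangular (Psi\<^sup>T * S * Psi + M) \<and>
             diag_mat (Psi\<^sup>T * S * Psi + M) = replicate d (gamma_star S))) \<and>
       (M_star S Psi)\<^sup>T = - M_star S Psi \<and>
       is_min_value P2_objective (P2_feasible S) m \<and>
       is_min_value (P1_objective S) (P1_feasible S) m"
    if Psi: "equalizing_basis S Psi" for Psi
  proof -
    have P: "orth_mat d Psi" and diag: "\<And>k. k < d \<Longrightarrow> (Psi\<^sup>T * S * Psi) $$ (k, k) = gamma_star S"
      using Psi by (auto simp: equalizing_basis_iff[OF S(1)])
    note Pc = orth_matD(1)[OF P]
    have "P2_objective (Psi, M_star S Psi) = m"
      using frobenius_norm_M_star[OF S(1) ST P diag] by (simp add: P2_objective_def m_def)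
    then have "is_min_value P2_objective (P2_feasible S) m"
      using opt(1)[OF Psi] P2_lower_bound[OF S(1) ST] unfolding is_min_value_def m_def by blast
    moreover have "is_min_value (P1_objective S) (P1_feasible S) m"
      using opt(2,4)[OF Psi] lower unfolding is_min_value_def by blast
    ultimately show ?thesis
      using M_star_triangular[OF S(1) Pc diag] M_star_unique[OF S(1) ST Pc] M_star_skew[OF S(1) ST Pc]
      by blast
  qed
  have assoc: "mat_inv_sqrt S * Psi * M_star S Psi * Psi\<^sup>T * mat_inv_sqrt S = J_star S Psi"
    if "Psi \<in> carrier_mat d d" for Psi
    using that mat_inv_sqrt(1)[OF S] M_star_carrier[OF S(1), of Psi]
    by (simp add: J_star_def assoc_mult_mat[of _ d d _ d _ d])
  \<comment> \<open>The value \<open>m\<close> is attained at \<open>J_star S Psi0\<close>, so a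
    minimizer cannot exceed it; conversely \<open>lower\<close> makes every feasible point with
    value at most \<open>m\<close> minimal.\<close>
  have "global_minimizers (P1_objective S) (P1_feasible S)
      = {J \<in> P1_feasible S. P1_objective S J \<le> m}"
    using opt(2,4)[OF Psi0] lower unfolding global_minimizers_def is_arg_min_def
    by (auto simp: not_less) (meson dual_order.trans not_less)+
  also have "\<dots> = {J_star S Psi | Psi. equalizing_basis S Psi}"
  proof (intro subset_antisym subsetI)
    fix J assume "J \<in> {J \<in> P1_feasible S. P1_objective S J \<le> m}"
    then show "J \<in> {J_star S Psi | Psi. equalizing_basis S Psi}"
      using P1_optimal_imp_J_star[OF S, folded m_def, of J] by blast
  next
    fix J assume "J \<in> {J_star S Psi | Psi. equalizing_basis S Psi}"
    then obtain Psi where "equalizing_basis S Psi" "J = J_star S Psi" by blast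
    then show "J \<in> {J \<in> P1_feasible S. P1_objective S J \<le> m}"
      using opt(2,4)[of Psi] by simp
  qed
  also have "\<dots> = {mat_inv_sqrt S * Psi * M_star S Psi * Psi\<^sup>T * mat_inv_sqrt S | Psi.
         Psi \<in> carrier_mat d d \<and> Psi\<^sup>T * Psi = 1\<^sub>m d \<and>
         diag_mat (Psi\<^sup>T * S * Psi) = replicate d (gamma_star S)}"
    unfolding equalizing_basis_iff_diag_mat[OF S(1)]
    by (intro Collect_cong ex_cong1) (metis assoc)
  finally show ?thesis
    using exI[of "equalizing_basis S", OF Psi0] part opt(1,3) tr m unfolding m_def[symmetric] by simp
qed

end
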